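(* Let $m\ge 1$, let $\delta\in\mathbb{F}_{2^m}^{*}$, let $n$ be an even positive integer, and let $F_1(x)=\sum_{i=0}^{n}c_i x^i$ be an $N_1$-polynomial of degree $n$ over $\mathbb{F}_{2^m}$. Suppose that $$\mathrm{Tr}_{2^m|2}\Big(\frac{c_1\delta}{c_0}\Big)=1\quad\text{and}\quad \mathrm{Tr}_{2^m|2}\Big(\frac{c_{n-1}}{\delta}\Big)=1 .$$ Define the sequence $(F_u(x))_{u\ge 1}$ by $$F_{u+1}(x)=x^{n2^{u-1}}F_u(x+\delta^2x^{-1}),\qquad u\ge 1.$$ Then, for every $u\ge 1$, $F_{u+1}(x)$ is an $N_1$-polynomial of degree $2^{u}n$ over $\mathbb{F}_{2^m}$.
   Context: For a prime power $q$ and $0\le k\le d-1$, an element $\alpha\in\mathbb{F}_{q^d}$ is called a $k$-normal element of $\mathbb{F}_{q^d}$ over $\mathbb{F}_q$ if $\deg\gcd\big(x^d-1,\ \sum_{i=0}^{d-1}\alpha^{q^i}x^{d-1-i}\big)=k$ (gcd taken in $\mathbb{F}_{q^d}[x]$). A monic irreducible polynomial $P(x)\in\mathbb{F}_q[x]$ of degree $d$ is called a $k$-normal polynomial, or $N_k$-polynomial, over $\mathbb{F}_q$ if its roots are $k$-normal elements of $\mathbb{F}_{q^d}$ over $\mathbb{F}_q$. $\mathrm{Tr}_{2^m|2}(\beta)=\sum_{i=0}^{m-1}\beta^{2^i}$ denotes the trace from $\mathbb{F}_{2^m}$ to $\mathbb{F}_2$. *)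

theory Defs
  imports
    "HOL-Algebra.Algebraic_Closure_Type"
    "HOL-Computational_Algebra.Computational_Algebra"
    "HOL-Library.Cardinality"
begin

text \<open>
  The base field of \<open>q\<close> elements is a type \<open>'a\<close> of class \<^class>\<open>finite_field\<close>, \<open>q = CARD('a)\<close>.
  All extensions of degree \<open>d\<close> are realised inside the algebraic closure \<open>'a alg_closure\<close>:
  the subfield with \<open>q\<^sup>d\<close> elements consists of the roots of \<open>X^(q^d) - X\<close>.
  Several names used below also exist in HOL-Algebra, hence the qualified constants.
\<close>

definition ext_field :: "nat \<Rightarrow> 'a::finite_field alg_closure set" where
  "ext_field d = {x. x ^ (CARD('a) ^ d) = x}"

definition normality_poly :: "nat \<Rightarrow> 'a::finite_field alg_closure \<Rightarrow> 'a alg_closure poly" where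
  "normality_poly d \<alpha> = (\<Sum>i<d. Polynomial.monom (\<alpha> ^ (CARD('a) ^ i)) (d - 1 - i))"

text \<open>
  The \<^const>\<open>gcd\<close> below is the monic gcd over the algebraic closure. By lemma
  \<open>gcd_over_ext_field\<close> its coefficients lie in the subfield \<open>ext_field d\<close>, so it is the
  monic gcd in the polynomial ring over that subfield.
\<close>

definition k_normal :: "nat \<Rightarrow> nat \<Rightarrow> 'a::finite_field alg_closure \<Rightarrow> bool" where
  "k_normal k d \<alpha> \<longleftrightarrow> k < d \<and> \<alpha> \<in> ext_field d \<and>
     Polynomial.degree (gcd (Polynomial.monom 1 d - 1) (normality_poly d \<alpha>)) = k"

definition N_poly :: "nat \<Rightarrow> 'a::finite_field poly \<Rightarrow> bool" where
  "N_poly k P \<longleftrightarrow> Polynomial.lead_coeff P = 1 \<and> Factorial_Ring.irreducible P \<and>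
     (\<forall>\<alpha>. poly (map_poly to_ac P) \<alpha> = 0 \<longrightarrow> k_normal k (Polynomial.degree P) \<alpha>)"

text \<open>The trace from the field with \<open>2^m\<close> elements to its prime field, with values in the big field.\<close>

definition abs_trace2 :: "nat \<Rightarrow> 'a::finite_field \<Rightarrow> 'a" where
  "abs_trace2 m \<beta> = (\<Sum>i<m. \<beta> ^ (2 ^ i))"

text \<open>Evaluation of a polynomial over \<open>'a\<close> at a rational function, an element of \<open>'a(x)\<close>.\<close>

abbreviation ratfun_const :: "'a::field \<Rightarrow> 'a poly fract" where
  "ratfun_const c \<equiv> to_fract [:c:]"

abbreviation ratfun_X :: "'a::field poly fract" where
  "ratfun_X \<equiv> to_fract [:0, 1:]"

definition subst_ratfun :: "'a::field poly \<Rightarrow> 'a poly fract \<Rightarrow> 'a poly fract" where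
  "subst_ratfun P r = poly (map_poly ratfun_const P) r"


subsection \<open>The gcd has coefficients in the extension field\<close>

lemma frob_add:
  assumes "prime p" "CARD('a::finite_field) = p ^ m"
  shows "(x + y :: 'a alg_closure) ^ (CARD('a) ^ d) = x ^ (CARD('a) ^ d) + y ^ (CARD('a) ^ d)"
proof -
  have pr: "prime CHAR('a)" by simp
  have "CHAR('a) dvd CARD('a)"
  proof -
    have "(\<Sum>y\<in>(UNIV::'a set). y) = (\<Sum>y\<in>UNIV. y + 1)"
      by (rule sum.reindex_bij_witness[of _ "\<lambda>y. y + 1" "\<lambda>y. y - 1"]) auto
    hence "of_nat CARD('a) = (0 :: 'a)" by (simp add: sum.distrib)
    thus ?thesis by (simp only: of_nat_eq_0_iff_char_dvd)
  qed
  hence "CHAR('a) dvd p" using assms pr prime_dvd_power by metis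
  hence "CHAR('a) = p" using assms(1) pr primes_dvd_imp_eq by blast
  hence "CARD('a) ^ d = CHAR('a alg_closure) ^ (m * d)" "prime CHAR('a alg_closure)"
    using assms by (simp_all add: power_mult)
  thus ?thesis using freshmans_dream' by blast
qed

lemma gcd_over_ext_field:
  fixes A B :: "'a::finite_field alg_closure poly"
  assumes p: "prime p" "CARD('a) = p ^ m"
    and A: "\<And>i. Polynomial.coeff A i \<in> ext_field d"
    and B: "\<And>i. Polynomial.coeff B i \<in> ext_field d"
  shows "Polynomial.coeff (gcd A B) i \<in> ext_field d"
proof (cases "gcd A B = 0")
  case True
  thus ?thesis by (simp add: ext_field_def power_0_left)
next
  case False
  define s :: "'a alg_closure \<Rightarrow> 'a alg_closure" where "s = (\<lambda>x. x ^ (CARD('a) ^ d))"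
  have s0 [simp]: "s 0 = 0" and s1 [simp]: "s 1 = 1" by (simp_all add: s_def power_0_left)
  have s_add: "s (x + y) = s x + s y" for x y
    unfolding s_def by (rule frob_add[OF p])
  have s_mult: "s (x * y) = s x * s y" for x y
    by (simp add: s_def power_mult_distrib)
  have s_sum: "s (sum f I) = (\<Sum>x\<in>I. s (f x))" for f and I :: "nat set"
    by (induction I rule: infinite_finite_induct) (simp_all add: s_add)
  have s_eq0: "s x = 0 \<longleftrightarrow> x = 0" for x by (simp add: s_def)
  have fixed: "map_poly s P = P" if "\<And>i. Polynomial.coeff P i \<in> ext_field d" for P
    using that by (intro poly_eqI) (simp add: coeff_map_poly ext_field_def s_def)
  have mult: "map_poly s (P * Q) = map_poly s P * map_poly s Q" for P Q
    by (intro poly_eqI) (simp add: coeff_map_poly coeff_mult s_sum s_mult)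
  have dvd: "map_poly s P dvd map_poly s Q" if "P dvd Q" for P Q
    using that by (auto elim!: dvdE simp: mult)
  let ?h = "gcd A B"
  have "map_poly s ?h dvd ?h"
    using dvd[of ?h A] dvd[of ?h B] fixed[OF A] fixed[OF B] by simp
  then obtain c where c: "?h = map_poly s ?h * c" by (elim dvdE)
  have deg: "Polynomial.degree (map_poly s ?h) = Polynomial.degree ?h"
    by (rule map_poly_degree_eq) (use False s_eq0 in auto)
  have nz: "map_poly s ?h \<noteq> 0" "c \<noteq> 0" using c False by auto
  have "Polynomial.degree c = 0"
    using c deg degree_mult_eq[OF nz] by simp
  then obtain a where a: "c = [:a:]" by (elim degree_eq_zeroE)
  have "unit_factor ?h = 1"
    using False by (simp add: unit_factor_gcd)
  hence monic: "Polynomial.lead_coeff ?h = 1"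
    by (simp add: unit_factor_poly_def one_pCons)
  have "Polynomial.lead_coeff (map_poly s ?h) = 1"
    by (simp add: deg coeff_map_poly monic)
  moreover have "Polynomial.lead_coeff ?h = Polynomial.lead_coeff (map_poly s ?h) * a"
    using arg_cong[OF c, of Polynomial.lead_coeff] unfolding lead_coeff_mult a by simp
  ultimately have "a = 1" using monic by simp
  hence "map_poly s ?h = ?h" using c a by (simp flip: one_pCons)
  hence "s (Polynomial.coeff ?h i) = Polynomial.coeff ?h i"
    by (metis coeff_map_poly s0)
  thus ?thesis by (simp add: ext_field_def s_def)
qed

lemma normality_poly_over_ext_field:
  assumes "\<alpha> \<in> ext_field d"
  shows "Polynomial.coeff (normality_poly d \<alpha>) i \<in> ext_field d"
proof (cases "i < d")
  case True
  have "Polynomial.coeff (normality_poly d \<alpha>) i =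
      (\<Sum>j<d. if j = d - 1 - i then \<alpha> ^ (CARD('a) ^ j) else 0)"
    unfolding normality_poly_def Polynomial.coeff_sum
    by (rule sum.cong) (use True in auto)
  also have "\<dots> = \<alpha> ^ (CARD('a) ^ (d - 1 - i))"
    using True by (simp add: sum.delta)
  finally show ?thesis
    using assms unfolding ext_field_def by (auto simp flip: power_mult simp: mult.commute) (simp add: power_mult)
next
  case False
  have "Polynomial.coeff (normality_poly d \<alpha>) i = 0"
    unfolding normality_poly_def Polynomial.coeff_sum
    by (rule sum.neutral) (use False in auto)
  thus ?thesis by (simp add: ext_field_def power_0_left)
qed


subsection \<open>The recursion for the sequence of polynomials is solvable\<close>

lemma subst_ratfun_poly:
  fixes P :: "'a::field poly"
  assumes "Polynomial.degree P \<le> N"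
  shows "ratfun_X ^ N * subst_ratfun P (ratfun_X + ratfun_const c * inverse ratfun_X) =
    to_fract (\<Sum>i\<le>N. [:Polynomial.coeff P i:] * [:0, 1:] ^ (N - i) * [:c, 0, 1:] ^ i)"
proof -
  let ?X = "ratfun_X :: 'a poly fract" and ?r = "ratfun_X + ratfun_const c * inverse ratfun_X :: 'a poly fract"
  have X: "?X \<noteq> 0" by simp
  have pw: "to_fract (x ^ k) = to_fract x ^ k" for x :: "'a poly" and k
    by (induction k) simp_all
  have "[:c, 0, 1:] = [:0, 1:] * [:0, 1:] + [:c:]" by simp
  hence Xr: "to_fract [:c, 0, 1:] = ?X * ?r"
    using X by (simp only: to_fract_add to_fract_mult) (simp add: field_simps)
  have d: "Polynomial.degree (map_poly ratfun_const P) \<le> N"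
    using map_poly_degree_leq[of "ratfun_const :: 'a \<Rightarrow> _" P] assms by simp
  have "subst_ratfun P ?r = (\<Sum>i\<le>N. ratfun_const (Polynomial.coeff P i) * ?r ^ i)"
    unfolding subst_ratfun_def poly_altdef
    by (rule sum.mono_neutral_cong_left) (use d in \<open>auto simp: coeff_map_poly coeff_eq_0 degree_map_poly le_degree\<close>)
  hence "?X ^ N * subst_ratfun P ?r = (\<Sum>i\<le>N. ?X ^ N * (ratfun_const (Polynomial.coeff P i) * ?r ^ i))"
    by (simp add: sum_distrib_left)
  also have "\<dots> = (\<Sum>i\<le>N. to_fract ([:Polynomial.coeff P i:] * [:0, 1:] ^ (N - i) * [:c, 0, 1:] ^ i))"
  proof (rule sum.cong)
    fix i assume "i \<in> {..N}"
    hence "?X ^ N = ?X ^ (N - i) * ?X ^ i" by (simp flip: power_add)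
    thus "?X ^ N * (ratfun_const (Polynomial.coeff P i) * ?r ^ i) =
        to_fract ([:Polynomial.coeff P i:] * [:0, 1:] ^ (N - i) * [:c, 0, 1:] ^ i)"
      by (simp only: to_fract_mult pw Xr power_mult_distrib mult_ac)
  qed simp
  finally show ?thesis by simp
qed

lemma sequence_exists:
  fixes P :: "'a::field poly"
  assumes "Polynomial.degree P = n"
  shows "\<exists>F. F 1 = P \<and> (\<forall>u\<ge>1. to_fract (F (u + 1)) =
    ratfun_X ^ (n * 2 ^ (u - 1)) * subst_ratfun (F u) (ratfun_X + ratfun_const c * inverse ratfun_X))"
proof -
  define T where "T N Q = (\<Sum>i\<le>N. [:Polynomial.coeff Q i:] * [:0, 1:] ^ (N - i) * [:c, 0, 1:] ^ i)"
    for N and Q :: "'a poly"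
  define G where "G = rec_nat P (\<lambda>v Q. T (n * 2 ^ v) Q)"
  have G0: "G 0 = P" and GS: "G (Suc v) = T (n * 2 ^ v) (G v)" for v
    by (simp_all add: G_def)
  have degT: "Polynomial.degree (T N Q) \<le> 2 * N" for N Q
    unfolding T_def
  proof (rule degree_sum_le)
    fix i assume i: "i \<in> {..N}"
    have "Polynomial.degree ([:Polynomial.coeff Q i:] * [:0, 1:] ^ (N - i) * [:c, 0, 1:] ^ i)
        \<le> (0 + 1 * (N - i)) + 2 * i"
      by (intro order.trans[OF degree_mult_le] add_mono order.trans[OF degree_power_le]) auto
    thus "Polynomial.degree ([:Polynomial.coeff Q i:] * [:0, 1:] ^ (N - i) * [:c, 0, 1:] ^ i) \<le> 2 * N"
      using i by simp
  qed simp
  have deg: "Polynomial.degree (G v) \<le> n * 2 ^ v" for v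
  proof (cases v)
    case (Suc w)
    thus ?thesis using degT[of "n * 2 ^ w" "G w"] by (simp add: GS mult_ac)
  qed (simp add: G0 assms)
  have "to_fract (G (Suc v)) =
      ratfun_X ^ (n * 2 ^ v) * subst_ratfun (G v) (ratfun_X + ratfun_const c * inverse ratfun_X)" for v
    unfolding GS subst_ratfun_poly[OF deg] T_def ..
  hence "to_fract (G (u + 1 - 1)) = ratfun_X ^ (n * 2 ^ (u - 1)) *
      subst_ratfun (G (u - 1)) (ratfun_X + ratfun_const c * inverse ratfun_X)" if "u \<ge> 1" for u
    using that by (cases u) auto
  thus ?thesis by (intro exI[of _ "\<lambda>u. G (u - 1)"]) (simp add: G0)
qed

end

theory Submission
  imports
    Defs
    "HOL-Number_Theory.Residues"
begin

text \<open>
  Let \<open>\<beta>\<close> be a root of \<open>F\<^sub>u\<^sub>+\<^sub>1\<close>, so that \<open>\<alpha> = \<beta> + \<delta>\<^sup>2/\<beta>\<close> is a root of \<open>F\<^sub>u\<close>, and let \<open>N\<close> be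
  the degree of \<open>F\<^sub>u\<close>. Then \<open>y = \<beta>/\<alpha>\<close> satisfies \<open>y\<^sup>2 + y = (\<delta>/\<alpha>)\<^sup>2\<close>, so if the absolute trace of
  \<open>\<delta>/\<alpha>\<close> is \<open>1\<close>, the Frobenius map \<open>\<sigma> = (x \<mapsto> x^(q^N))\<close> sends \<open>y\<close> to \<open>y + 1\<close> and \<open>\<beta>\<close> to \<open>\<beta> + \<alpha>\<close>.
  Hence \<open>\<beta>\<close> has degree \<open>2N\<close>. Since \<open>\<beta> + \<sigma>\<beta> = \<alpha>\<close> and \<open>\<delta>/\<beta> + \<sigma>(\<delta>/\<beta>) = \<alpha>/\<delta>\<close>, the traces of
  \<open>\<delta>/\<beta>\<close> and \<open>\<beta>/\<delta>\<close> are both equal to that of \<open>\<alpha>/\<delta>\<close>, and the two trace conditions are inherited.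

  For normality, write \<open>g\<close> for the normality polynomial. Then
  \<open>g\<^sub>2\<^sub>N(\<beta>) = (X^N - 1) g\<^sub>N(\<beta>) + g\<^sub>N(\<alpha>)\<close>, so \<open>g\<^sub>2\<^sub>N(\<beta>)\<close> and \<open>g\<^sub>N(\<alpha>)\<close> have the same gcd with
  \<open>X^N - 1\<close>, of degree one. As \<open>N\<close> is even, \<open>X^N - 1\<close> is a square, so the linear gcd divides it
  twice, and passing to \<open>X^(2N) - 1 = (X^N - 1)\<^sup>2\<close> does not enlarge the gcd.
\<close>

subsection \<open>Polynomials over the algebraic closure\<close>

lemma degree_map_poly_to_ac [simp]: "Polynomial.degree (map_poly to_ac P) = Polynomial.degree P"
  by (simp add: degree_map_poly)

lemma coeff_map_poly_to_ac [simp]: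
  "Polynomial.coeff (map_poly to_ac P) i = to_ac (Polynomial.coeff P i)"
  by (simp add: coeff_map_poly)

lemma map_poly_to_ac_add: "map_poly to_ac (P + Q) = map_poly to_ac P + map_poly to_ac Q"
  by (intro poly_eqI) simp

lemma map_poly_to_ac_mult: "map_poly to_ac (P * Q) = map_poly to_ac P * map_poly to_ac Q"
  by (intro poly_eqI) (simp add: coeff_mult to_ac_sum)

lemma map_poly_to_ac_smult:
  "map_poly to_ac (Polynomial.smult c P) = Polynomial.smult (to_ac c) (map_poly to_ac P)"
  by (intro poly_eqI) simp

lemma map_poly_to_ac_power: "map_poly to_ac (P ^ k) = map_poly to_ac P ^ k"
  by (induction k) (simp_all add: map_poly_to_ac_mult)

lemma map_poly_to_ac_sum: "map_poly to_ac (\<Sum>i\<in>I. P i) = (\<Sum>i\<in>I. map_poly to_ac (P i))"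
  by (induction I rule: infinite_finite_induct) (simp_all add: map_poly_to_ac_add)

lemma map_poly_to_ac_eq_iff: "map_poly to_ac P = map_poly to_ac Q \<longleftrightarrow> P = Q"
  by (metis coeff_map_poly_to_ac poly_eqI to_ac_eq_iff)

text \<open>Division with remainder shows that a nonzero polynomial \<open>M\<close> of least degree
  vanishing at \<alpha> divides every polynomial over the base field that vanishes there. It is not
  a unit, as a nonzero constant has no root, so the irreducible \<open>P\<close>, a multiple of
  \<open>M\<close>, also divides \<open>M\<close>.\<close>

lemma irreducible_dvd_of_common_root:
  fixes P R :: "'a::field poly"
  assumes "Factorial_Ring.irreducible P"
    and "poly (map_poly to_ac P) \<alpha> = 0" and "poly (map_poly to_ac R) \<alpha> = 0"
  shows "P dvd R"
proof -
  define root where "root Q \<longleftrightarrow> Q \<noteq> 0 \<and> poly (map_poly to_ac Q) \<alpha> = 0" for Q :: "'a poly"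
  have P0: "P \<noteq> 0" using assms(1) by auto
  obtain M where M: "root M" and least: "\<And>Q. root Q \<Longrightarrow> Polynomial.degree M \<le> Polynomial.degree Q"
    using ex_has_least_nat[of root P Polynomial.degree] assms(2) P0 by (auto simp: root_def)
  have dvd: "M dvd Q" if Q: "poly (map_poly to_ac Q) \<alpha> = 0" for Q
  proof (rule ccontr)
    assume "\<not> M dvd Q"
    hence nz: "Q mod M \<noteq> 0" by (simp add: mod_eq_0_iff_dvd)
    have "map_poly to_ac Q = map_poly to_ac (Q div M) * map_poly to_ac M + map_poly to_ac (Q mod M)"
      by (metis div_mult_mod_eq map_poly_to_ac_add map_poly_to_ac_mult)
    hence "root (Q mod M)" using Q M nz by (simp add: root_def)
    thus False using least[of "Q mod M"] degree_mod_less'[of M Q] M nz by (simp add: root_def)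
  qed
  have "\<not> is_unit M"
  proof
    assume "is_unit M"
    hence "Polynomial.degree M = 0" using M is_unit_iff_degree by (auto simp: root_def)
    then obtain c where "M = [:c:]" by (elim degree_eq_zeroE)
    thus False using M by (simp add: root_def map_poly_pCons)
  qed
  hence "P dvd M"
    using dvd[OF assms(2)] assms(1) by (metis dvd_refl irreducibleD' )
  thus ?thesis using dvd[OF assms(3)] by (rule dvd_trans)
qed

section \<open>Coefficients as symmetric functions of the roots\<close>

lemma coeff_prod_linear_subleading:
  fixes f :: "nat \<Rightarrow> 'b::field"
  assumes "n > 0"
  shows "Polynomial.coeff (\<Prod>i<n. [:- f i, 1:]) (n - 1) = - (\<Sum>i<n. f i)"
  using assms
proof (induction n)
  case (Suc n)
  let ?Q = "\<Prod>i<n. [:- f i, 1:]"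
  have "Polynomial.degree ?Q = n" by (subst degree_prod_eq_sum_degree) auto
  moreover have "Polynomial.lead_coeff ?Q = 1" by (simp add: lead_coeff_prod)
  ultimately have "Polynomial.coeff ?Q n = 1" by simp
  moreover have "(\<Prod>i<Suc n. [:- f i, 1:]) = [:- f n, 1:] * ?Q"
    by (simp only: prod.lessThan_Suc mult.commute)
  ultimately show ?case using Suc.IH by (cases n) (simp_all del: prod.lessThan_Suc)
qed simp

text \<open>Logarithmic derivative of the product at 0. For a Frobenius orbit \<open>f\<close> it
  makes c_1/c_0 the negative of the relative trace of the inverse of a root.\<close>

lemma coeff_prod_linear_1:
  fixes f :: "nat \<Rightarrow> 'b::field"
  assumes "\<And>i. i < n \<Longrightarrow> f i \<noteq> 0"
  shows "Polynomial.coeff (\<Prod>i<n. [:- f i, 1:]) 1 =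
    - Polynomial.coeff (\<Prod>i<n. [:- f i, 1:]) 0 * (\<Sum>i<n. 1 / f i)"
  using assms
proof (induction n)
  case (Suc n)
  let ?Q = "\<Prod>i<n. [:- f i, 1:]"
  have "(\<Prod>i<Suc n. [:- f i, 1:]) = [:- f n, 1:] * ?Q" by simp
  moreover have "f n \<noteq> 0" using Suc.prems by simp
  ultimately show ?case using Suc by (simp add: algebra_simps)
qed simp

text \<open>The sort is spelled out because \<^typ>\<open>'a::field alg_closure\<close> is not an instance of \<^class>\<open>field_gcd\<close>.\<close>

lemma poly_gcd_square_eq:
  fixes B C :: "'b::{field,factorial_ring_gcd,semiring_gcd_mult_normalize} poly"
  assumes "Polynomial.degree (gcd (B\<^sup>2) C) = 1"
  shows "gcd ((B\<^sup>2)\<^sup>2) C = gcd (B\<^sup>2) C"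
proof -
  define D where "D = gcd (B\<^sup>2) C"
  have D0: "D \<noteq> 0" using assms by (auto simp: D_def)
  \<comment> \<open>\<open>gcd B C\<close> divides \<open>D\<close> and is not a unit, since
    otherwise \<open>B\<^sup>2\<close> and \<open>C\<close> would be coprime. As \<open>D\<close>
    has degree one, the two agree up to a unit.\<close>
  have "D dvd B"
  proof -
    have "gcd B C dvd D" by (auto simp: D_def power2_eq_square)
    then obtain E where E: "D = gcd B C * E" by (elim dvdE)
    have nz: "gcd B C \<noteq> 0" "E \<noteq> 0" using E D0 by auto
    have "\<not> coprime B C"
    proof
      assume "coprime B C"
      hence "D = 1" by (simp add: D_def)
      thus False using assms D_def by simp
    qed
    hence "\<not> is_unit (gcd B C)" by (simp add: coprime_iff_gcd_eq_1 is_unit_gcd)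
    hence "Polynomial.degree (gcd B C) \<noteq> 0" using nz is_unit_iff_degree by blast
    moreover have "Polynomial.degree D = Polynomial.degree (gcd B C) + Polynomial.degree E"
      unfolding E using nz by (rule degree_mult_eq)
    ultimately have "Polynomial.degree E = 0" using assms by (simp add: D_def)
    hence "is_unit E" using nz is_unit_iff_degree by blast
    hence "D dvd gcd B C" by (simp add: E mult_unit_dvd_iff)
    thus ?thesis by simp
  qed
  then obtain B1 where B1: "B = D * B1" by (elim dvdE)
  obtain C1 where C1: "C = D * C1" unfolding D_def by (metis gcd_dvd2 dvdE)
  have nD: "normalize D = D" by (simp add: D_def)
  have "D * gcd (B * B1) C1 = gcd (D * (B * B1)) (D * C1)"
    using gcd_mult_left[of D "B * B1" C1] nD by (simp add: normalize_mult)
  also have "D * (B * B1) = B\<^sup>2" by (simp add: B1 power2_eq_square mult_ac)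
  also have "gcd (B\<^sup>2) (D * C1) = D" by (subst C1[symmetric]) (rule D_def[symmetric])
  finally have "coprime (B * B1) C1" using D0 by (simp add: coprime_iff_gcd_eq_1)
  \<comment> \<open>The cofactor of \<open>D\<close> in \<open>B\<^sup>2\<close> is
    \<open>B * B1\<close>, and in the fourth power of \<open>B\<close> it is
    \<open>B ^ 3 * B1\<close>. Both have the same prime factors, so coprimality with
    \<open>C1\<close> carries over.\<close>
  hence cop: "coprime (B ^ 3 * B1) C1" by simp
  have "(B\<^sup>2)\<^sup>2 = B * B ^ 3" by (simp add: power2_eq_square power3_eq_cube mult_ac)
  also have "\<dots> = D * (B ^ 3 * B1)" by (subst (1) B1) (simp only: mult_ac)
  finally have "gcd ((B\<^sup>2)\<^sup>2) C = gcd (D * (B ^ 3 * B1)) (D * C1)" using C1 by simp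
  also have "\<dots> = D * gcd (B ^ 3 * B1) C1"
    using gcd_mult_left[of D "B ^ 3 * B1" C1] nD by (simp add: normalize_mult)
  also have "\<dots> = D" using cop by simp
  finally show ?thesis by (simp add: D_def)
qed

subsection \<open>Frobenius orbits\<close>

lemma to_ac_power_card: "(to_ac (c :: 'a::finite_field)) ^ (CARD('a) ^ i) = to_ac c"
  using finite_field_power_card_power_eq_same[of "CARD('a) ^ i" i c] by (simp flip: to_ac_power)

text \<open>X^q - X has at most q roots, and the q elements of the base field already account for
  all of them.\<close>

lemma power_card_eq_imp_in_range_to_ac:
  fixes x :: "'a::finite_field alg_closure"
  assumes "x ^ CARD('a) = x"
  shows "x \<in> range to_ac"
proof -
  define P :: "'a alg_closure poly" where "P = Polynomial.monom 1 CARD('a) - Polynomial.monom 1 1"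
  have c1: "CARD('a) > 1"
    using card_mono[of "UNIV :: 'a set" "{0, 1}"] by simp
  have "Polynomial.coeff P CARD('a) = 1" using c1 by (simp add: P_def)
  hence P0: "P \<noteq> 0" by auto
  have "Polynomial.degree P \<le> CARD('a)"
    unfolding P_def using c1 by (intro degree_diff_le) (auto simp: degree_monom_eq)
  hence "card {x. poly P x = 0} \<le> card (range (to_ac :: 'a \<Rightarrow> _))"
    using card_poly_roots_bound[OF P0] by (simp add: card_image inj_to_ac)
  moreover have "range to_ac \<subseteq> {x. poly P x = 0}"
    by (auto simp: P_def poly_monom finite_field_power_card_eq_same simp flip: to_ac_power)
  ultimately have "range to_ac = {x. poly P x = 0}"
    using poly_roots_finite[OF P0] by (intro card_seteq) auto
  moreover have "poly P x = 0" using assms by (simp add: P_def poly_monom)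
  ultimately show ?thesis by blast
qed

context
  fixes p m :: nat
  assumes p: "prime p" and card: "CARD('a::finite_field) = p ^ m"
begin

lemma frob_sum:
  fixes f :: "'b \<Rightarrow> 'a alg_closure"
  shows "(\<Sum>i\<in>I. f i) ^ (CARD('a) ^ d) = (\<Sum>i\<in>I. f i ^ (CARD('a) ^ d))"
  by (induction I rule: infinite_finite_induct) (simp_all add: frob_add[OF p card] power_0_left)

lemma frob_uminus: "(- x :: 'a alg_closure) ^ CARD('a) = - (x ^ CARD('a))"
  using frob_add[OF p card, of x "- x" 1] by (simp add: power_0_left eq_neg_iff_add_eq_0 add.commute)

lemma poly_map_poly_frob:
  "poly (map_poly to_ac P) ((x :: 'a alg_closure) ^ (CARD('a) ^ i)) = poly (map_poly to_ac P) x ^ (CARD('a) ^ i)"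
  by (simp add: poly_altdef frob_sum power_mult_distrib to_ac_power_card flip: power_mult)
    (simp add: mult.commute)

text \<open>The q-th power map on coefficients sends each linear factor to the next and, by the
  assumption, the last to the first. The coefficients of the product are therefore fixed and lie in
  the base field. The period \<open>e\<close> may be a proper multiple of the orbit length, in which
  case factors repeat.\<close>

lemma orbit_poly_over_base:
  fixes \<alpha> :: "'a alg_closure"
  assumes "\<alpha> ^ (CARD('a) ^ e) = \<alpha>"
  shows "\<exists>R. map_poly to_ac R = (\<Prod>i<e. [:- (\<alpha> ^ (CARD('a) ^ i)), 1:])"
proof -
  define s :: "'a alg_closure \<Rightarrow> 'a alg_closure" where "s = (\<lambda>x. x ^ CARD('a))"
  have s0: "s 0 = 0" and s1: "s 1 = 1" by (simp_all add: s_def power_0_left)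
  have s_sum: "s (sum f I) = (\<Sum>x\<in>I. s (f x))" for f and I :: "nat set"
    using frob_sum[of f I 1] by (simp add: s_def)
  have mult: "map_poly s (P * Q) = map_poly s P * map_poly s Q" for P Q
    by (intro poly_eqI) (simp add: coeff_map_poly s0 coeff_mult s_sum, simp add: s_def power_mult_distrib)
  have prod: "map_poly s (\<Prod>i<k. Q i) = (\<Prod>i<k. map_poly s (Q i))" for Q and k :: nat
    by (induction k) (simp_all add: mult s1)
  define L where "L i = [:- (\<alpha> ^ (CARD('a) ^ i)), 1:]" for i
  have "map_poly s (L i) = L (Suc i)" for i
    by (simp add: L_def map_poly_pCons s0 s1) (simp add: s_def frob_uminus mult.commute flip: power_mult)
  hence "map_poly s (\<Prod>i<e. L i) = (\<Prod>i<e. L (Suc i))" by (simp add: prod)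
  also have "\<dots> = (\<Prod>i<e. L i)"
  proof -
    have "L e = L 0" using assms by (simp add: L_def)
    \<comment> \<open>Both sides are the product of \<open>L 0\<close>, ..., \<open>L e\<close>,
      with its first or its last factor split off.\<close>
    hence "L 0 * (\<Prod>i<e. L (Suc i)) = L 0 * (\<Prod>i<e. L i)"
      using prod.lessThan_Suc_shift[of L e] by (simp only: prod.lessThan_Suc mult.commute)
    moreover have "L 0 \<noteq> 0" by (simp add: L_def)
    ultimately show ?thesis using mult_left_cancel by blast
  qed
  finally have fixed: "s (Polynomial.coeff (\<Prod>i<e. L i) j) = Polynomial.coeff (\<Prod>i<e. L i) j" for j
    by (metis coeff_map_poly s0)
  have "map_poly to_ac (map_poly of_ac (\<Prod>i<e. L i)) = (\<Prod>i<e. L i)"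
    using fixed power_card_eq_imp_in_range_to_ac[where 'a = 'a]
    by (intro poly_eqI) (simp add: coeff_map_poly s_def to_ac_of_ac)
  thus ?thesis unfolding L_def by blast
qed

context
  fixes P :: "'a poly" and \<alpha> :: "'a alg_closure"
  assumes root: "poly (map_poly to_ac P) \<alpha> = 0"
    and closed: "\<alpha> ^ (CARD('a) ^ Polynomial.degree P) = \<alpha>"
begin

text \<open>The product over \<open>i\<close> conjugates lies over the base field, has degree
  \<open>i\<close> and vanishes at \<alpha>, so the irreducible \<open>P\<close> divides it.\<close>

lemma degree_le_orbit:
  assumes "Factorial_Ring.irreducible P" and "i > 0" and "\<alpha> ^ (CARD('a) ^ i) = \<alpha>"
  shows "Polynomial.degree P \<le> i"
proof -
  obtain R where R: "map_poly to_ac R = (\<Prod>j<i. [:- (\<alpha> ^ (CARD('a) ^ j)), 1:])"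
    using orbit_poly_over_base[OF assms(3)] by blast
  have "Polynomial.degree (map_poly to_ac R) = i"
    unfolding R by (subst degree_prod_eq_sum_degree) auto
  moreover have "poly (map_poly to_ac R) \<alpha> = 0"
    unfolding R using assms(2) by (auto simp: poly_prod intro!: bexI[of _ 0])
  hence "P dvd R" by (rule irreducible_dvd_of_common_root[OF assms(1) root])
  ultimately show ?thesis
    using dvd_imp_degree_le[of P R] assms(2) by fastforce
qed

lemma irreducible_eq_orbit_poly:
  assumes "Factorial_Ring.irreducible P" and "Polynomial.lead_coeff P = 1" and "Polynomial.degree P > 0"
  shows "map_poly to_ac P = (\<Prod>i<Polynomial.degree P. [:- (\<alpha> ^ (CARD('a) ^ i)), 1:])"
proof -
  define d where "d = Polynomial.degree P"
  obtain R where R: "map_poly to_ac R = (\<Prod>i<d. [:- (\<alpha> ^ (CARD('a) ^ i)), 1:])"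
    using orbit_poly_over_base[OF closed] d_def by blast
  have "Polynomial.degree (map_poly to_ac R) = d"
    unfolding R by (subst degree_prod_eq_sum_degree) auto
  hence dR: "Polynomial.degree R = d" by simp
  have "Polynomial.lead_coeff (map_poly to_ac R) = 1"
    unfolding R by (simp add: lead_coeff_prod)
  hence lR: "Polynomial.lead_coeff R = 1" by simp
  have "poly (map_poly to_ac R) \<alpha> = 0"
    unfolding R using assms(3) by (auto simp: poly_prod d_def intro!: bexI[of _ 0])
  then obtain Q where Q: "R = P * Q"
    using irreducible_dvd_of_common_root[OF assms(1) root] dvdE by blast
  have nz: "P \<noteq> 0" "Q \<noteq> 0" using lR Q by auto
  have "Polynomial.degree Q = 0" using dR degree_mult_eq[OF nz] by (simp add: Q d_def)
  then obtain c where c: "Q = [:c:]" by (elim degree_eq_zeroE)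
  have "c = 1" using lR lead_coeff_mult[of P Q] assms(2) by (simp add: Q c)
  hence "R = P" using Q c by (simp flip: one_pCons)
  thus ?thesis using R by (simp add: d_def)
qed

text \<open>The conjugates of \<alpha> are distinct up to index \<open>degree P\<close>, and all are
  roots of any polynomial over the base field that vanishes at \<alpha>. In a factorization of
  \<open>P\<close>, the factor vanishing at \<alpha> thus has full degree and the other one is
  constant.\<close>

lemma irreducible_of_orbit:
  assumes "Polynomial.degree P > 0"
    and period: "\<And>i. 0 < i \<Longrightarrow> i < Polynomial.degree P \<Longrightarrow> \<alpha> ^ (CARD('a) ^ i) \<noteq> \<alpha>"
  shows "Factorial_Ring.irreducible P"
proof -
  define d where "d = Polynomial.degree P"
  have P0: "P \<noteq> 0" using assms(1) by auto
  have ne: "\<alpha> ^ (CARD('a) ^ i) \<noteq> \<alpha> ^ (CARD('a) ^ j)" if "i < j" "j < d" for i j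
  proof
    assume eq: "\<alpha> ^ (CARD('a) ^ i) = \<alpha> ^ (CARD('a) ^ j)"
    \<comment> \<open>Applying Frobenius \<open>d - j\<close> more times to two equal conjugates
      brings \<alpha> back after fewer than \<open>d\<close> steps.\<close>
    have "\<alpha> ^ (CARD('a) ^ (i + (d - j))) = (\<alpha> ^ (CARD('a) ^ i)) ^ (CARD('a) ^ (d - j))"
      by (simp add: power_add power_mult)
    also have "\<dots> = \<alpha> ^ (CARD('a) ^ (j + (d - j)))" unfolding eq by (simp add: power_add power_mult)
    also have "\<dots> = \<alpha>" using that closed by (simp add: d_def)
    finally have "\<alpha> ^ (CARD('a) ^ (i + (d - j))) = \<alpha>" .
    moreover have "0 < i + (d - j)" "i + (d - j) < d" using that by simp_all
    ultimately show False using period[of "i + (d - j)"] by (simp add: d_def)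
  qed
  hence inj: "inj_on (\<lambda>i. \<alpha> ^ (CARD('a) ^ i)) {..<d}"
    by (intro linorder_inj_onI) auto
  have deg_ge: "d \<le> Polynomial.degree Q" if "Q \<noteq> 0" "poly (map_poly to_ac Q) \<alpha> = 0" for Q
  proof -
    have nz: "map_poly to_ac Q \<noteq> 0" using that(1) map_poly_to_ac_eq_iff[of Q 0] by simp
    have "d = card ((\<lambda>i. \<alpha> ^ (CARD('a) ^ i)) ` {..<d})" using inj by (simp add: card_image)
    also have "\<dots> \<le> card {x. poly (map_poly to_ac Q) x = 0}"
      using poly_roots_finite[OF nz] that(2)
      by (intro card_mono) (auto simp: poly_map_poly_frob power_0_left)
    also have "\<dots> \<le> Polynomial.degree Q" using card_poly_roots_bound[OF nz] by simp
    finally show ?thesis .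
  qed
  show ?thesis
  proof (rule irreducibleI)
    show "\<not> is_unit P" using assms(1) is_unit_iff_degree[OF P0] by linarith
  next
    fix Q R assume PQR: "P = Q * R"
    hence nz: "Q \<noteq> 0" "R \<noteq> 0" using P0 by auto
    have "d = Polynomial.degree Q + Polynomial.degree R"
      unfolding d_def PQR using nz by (rule degree_mult_eq)
    moreover have "poly (map_poly to_ac Q) \<alpha> = 0 \<or> poly (map_poly to_ac R) \<alpha> = 0"
      using root by (simp add: PQR map_poly_to_ac_mult)
    ultimately have "Polynomial.degree R = 0 \<or> Polynomial.degree Q = 0"
      using deg_ge nz by force
    thus "is_unit Q \<or> is_unit R" using is_unit_iff_degree[OF nz(1)] is_unit_iff_degree[OF nz(2)] by blast
  qed (fact P0)
qed

end

end

subsection \<open>Characteristic two\<close>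

text \<open>The formula of \<open>abs_trace2\<close> over an arbitrary field, so that it applies in
  the algebraic closure. With \<open>k = m * n\<close> it is the absolute trace of the field with
  q^n elements.\<close>

definition trace_sum :: "nat \<Rightarrow> 'b::field \<Rightarrow> 'b" where
  "trace_sum k x = (\<Sum>i<k. x ^ (2 ^ i))"

lemma to_ac_abs_trace2: "to_ac (abs_trace2 k x) = trace_sum k (to_ac x)"
  by (simp add: abs_trace2_def trace_sum_def to_ac_sum)

lemma sum_lessThan_add:
  fixes f :: "nat \<Rightarrow> 'b::comm_monoid_add"
  shows "(\<Sum>i<k + l. f i) = (\<Sum>i<k. f i) + (\<Sum>i<l. f (k + i))"
  by (induction l) (simp_all add: add.assoc)

context
  fixes m :: nat
  assumes card2: "CARD('a::finite_field) = 2 ^ m"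
begin

lemma CHAR_2: "CHAR('a) = 2"
proof -
  have "CHAR('a) dvd 2 ^ m" using CHAR_dvd_CARD[where 'a = 'a] card2 by simp
  moreover have "prime CHAR('a)" by simp
  ultimately show ?thesis
    using prime_dvd_power primes_dvd_imp_eq two_is_prime_nat by blast
qed

lemma add_self_2: "(x :: 'a alg_closure) + x = 0"
proof -
  have "(of_nat 2 :: 'a alg_closure) = 0" by (simp only: of_nat_eq_0_iff_char_dvd) (simp add: CHAR_2)
  hence "(2 :: 'a alg_closure) = 0" by simp
  thus ?thesis by (simp flip: mult_2)
qed

lemma uminus_2: "- (x :: 'a alg_closure) = x"
  using add_self_2 by (metis minus_unique)

lemma add_cancel_2: "(x :: 'a alg_closure) + (x + y) = y" "(x + y) + x = y"
  by (metis add.assoc add.commute add_0 add_self_2)+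

lemma frob2_add: "(x + y :: 'a alg_closure) ^ (2 ^ i) = x ^ (2 ^ i) + y ^ (2 ^ i)"
  by (rule freshmans_dream'[of _ i]) (simp_all add: CHAR_2)

lemma trace_sum_add: "trace_sum k (x + y :: 'a alg_closure) = trace_sum k x + trace_sum k y"
  by (simp add: trace_sum_def frob2_add sum.distrib)

lemma trace_sum_power2: "trace_sum k ((x :: 'a alg_closure)\<^sup>2) = (trace_sum k x)\<^sup>2"
proof -
  have "(\<Sum>i<k. x ^ (2 ^ i)) ^ (2 ^ 1) = (\<Sum>i<k. (x ^ (2 ^ i)) ^ (2 ^ 1))"
    by (rule freshmans_dream_sum'[of _ 1]) (simp_all add: CHAR_2)
  thus ?thesis by (simp add: trace_sum_def mult.commute flip: power_mult)
qed

text \<open>Every intermediate power occurs twice and cancels in characteristic two.\<close>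

lemma trace_sum_telescope: "trace_sum k (x\<^sup>2 + x :: 'a alg_closure) = x ^ (2 ^ k) + x"
proof (induction k)
  case (Suc k)
  have "trace_sum (Suc k) (x\<^sup>2 + x) = (x ^ (2 ^ k) + x) + ((x\<^sup>2) ^ (2 ^ k) + x ^ (2 ^ k))"
    using Suc by (simp add: trace_sum_def frob2_add)
  also have "\<dots> = x ^ (2 ^ Suc k) + x + (x ^ (2 ^ k) + x ^ (2 ^ k))"
    by (simp add: algebra_simps flip: power_mult)
  finally show ?case by (simp add: add_self_2)
qed (simp add: trace_sum_def add_self_2)

lemma trace_sum_append:
  "trace_sum (m * (k + l)) (x :: 'a alg_closure) =
    trace_sum (m * k) x + trace_sum (m * l) (x ^ (CARD('a) ^ k))"
  by (simp add: trace_sum_def distrib_left sum_lessThan_add card2 power_add flip: power_mult)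

text \<open>Transitivity of the trace: the \<open>m * n\<close> powers fall into \<open>n\<close>
  blocks of length \<open>m\<close>, each starting at a q^i-th power of \<open>x\<close>.\<close>

lemma trace_sum_tower:
  "trace_sum (m * n) (x :: 'a alg_closure) = trace_sum m (\<Sum>i<n. x ^ (CARD('a) ^ i))"
proof (induction n)
  case 0
  show ?case by (simp add: trace_sum_def power_0_left)
next
  case (Suc n)
  show ?case using trace_sum_append[of n 1 x] Suc by (simp add: trace_sum_add)
qed

lemma frob_root_of_trace_1:
  fixes \<alpha> \<beta> d :: "'a alg_closure"
  assumes "\<alpha> \<noteq> 0" and "\<beta> \<noteq> 0" and \<alpha>: "\<alpha> = \<beta> + d\<^sup>2 / \<beta>"
    and closed: "\<alpha> ^ (CARD('a) ^ n) = \<alpha>" and tr: "trace_sum (m * n) (d / \<alpha>) = 1"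
  shows "\<beta> ^ (CARD('a) ^ n) = \<beta> + \<alpha>"
proof -
  \<comment> \<open>This scaling brings the quadratic equation X^2 + \<alpha> X + d^2 = 0 for
    \<beta> into Artin-Schreier form.\<close>
  define y where "y = \<beta> / \<alpha>"
  have "\<alpha> * \<beta> = \<beta>\<^sup>2 + d\<^sup>2" using assms(2)
    unfolding \<alpha> by (simp add: distrib_right power2_eq_square)
  hence "d\<^sup>2 = \<beta>\<^sup>2 + \<alpha> * \<beta>" by (simp add: add_cancel_2)
  hence "(d / \<alpha>)\<^sup>2 = y\<^sup>2 + y" using assms(1)
    by (simp add: y_def power_divide add_divide_distrib power2_eq_square)
  hence "y ^ (2 ^ (m * n)) + y = (trace_sum (m * n) (d / \<alpha>))\<^sup>2"
    using trace_sum_telescope[of "m * n" y] by (simp flip: trace_sum_power2)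
  hence "y + (y ^ (2 ^ (m * n)) + y) = y + 1" by (simp add: tr)
  hence "y ^ (2 ^ (m * n)) = y + 1" by (simp add: add_cancel_2 add.commute)
  hence y: "y ^ (CARD('a) ^ n) = y + 1" by (simp add: card2 flip: power_mult)
  have "\<beta> = y * \<alpha>" using assms(1) by (simp add: y_def)
  thus ?thesis using y closed by (simp add: power_mult_distrib distrib_right)
qed

section \<open>Normality over the quadratic extension\<close>

lemma monom_minus_1_square:
  "(Polynomial.monom 1 k - 1 :: 'a alg_closure poly)\<^sup>2 = Polynomial.monom 1 (2 * k) - 1"
proof -
  have self: "p + p = 0" for p :: "'a alg_closure poly"
    by (intro poly_eqI) (simp only: Polynomial.coeff_add add_self_2 Polynomial.coeff_0)
  hence neg: "p = - p" for p :: "'a alg_closure poly" by (metis add_eq_0_iff)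
  have "(p - 1)\<^sup>2 = p * p - (p + p) + 1" for p :: "'a alg_closure poly"
    by (simp add: power2_eq_square algebra_simps)
  hence "(Polynomial.monom 1 k - 1 :: 'a alg_closure poly)\<^sup>2 = Polynomial.monom 1 (k + k) + 1"
    by (simp only: self diff_0_right mult_monom mult_1)
  also have "\<dots> = Polynomial.monom 1 (2 * k) - 1"
    using neg by (metis mult_2 diff_conv_add_uminus)
  finally show ?thesis .
qed

text \<open>The first \<open>n\<close> conjugates of \<beta> contribute
  \<open>normality_poly n \<beta>\<close> shifted by X^n. The last \<open>n\<close> are the first
  ones plus the conjugates of \<alpha>, and they contribute the sum of both normality polynomials;
  signs do not matter in characteristic two.\<close>

lemma normality_poly_double:
  fixes \<alpha> \<beta> :: "'a alg_closure"
  assumes "\<beta> ^ (CARD('a) ^ n) = \<beta> + \<alpha>"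
  shows "normality_poly (2 * n) \<beta> =
    normality_poly n \<beta> * (Polynomial.monom 1 n - 1) + normality_poly n \<alpha>"
proof -
  let ?G = "normality_poly n \<beta>"
  have low: "(\<Sum>i<n. Polynomial.monom (\<beta> ^ (CARD('a) ^ i)) (2 * n - 1 - i)) = Polynomial.monom 1 n * ?G"
    unfolding normality_poly_def sum_distrib_left
    by (rule sum.cong) (auto simp: mult_monom intro!: arg_cong[of _ _ "Polynomial.monom _"])
  have "\<beta> ^ (CARD('a) ^ (n + i)) = \<beta> ^ (CARD('a) ^ i) + \<alpha> ^ (CARD('a) ^ i)" for i
    by (simp add: power_add power_mult assms frob_add[OF two_is_prime_nat card2])
  hence high: "(\<Sum>i<n. Polynomial.monom (\<beta> ^ (CARD('a) ^ (n + i))) (2 * n - 1 - (n + i))) =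
      ?G + normality_poly n \<alpha>"
    unfolding normality_poly_def
    by (simp add: add_monom[symmetric] sum.distrib)
  have "normality_poly (2 * n) \<beta> =
      (\<Sum>i<n + n. Polynomial.monom (\<beta> ^ (CARD('a) ^ i)) (2 * n - 1 - i))"
    by (simp add: normality_poly_def mult_2)
  hence "normality_poly (2 * n) \<beta> = Polynomial.monom 1 n * ?G + (?G + normality_poly n \<alpha>)"
    by (simp only: sum_lessThan_add low high)
  moreover have "?G = - ?G" by (intro poly_eqI) (simp only: Polynomial.coeff_minus uminus_2)
  moreover have "?G * (Polynomial.monom 1 n - 1) = Polynomial.monom 1 n * ?G + - ?G"
    by (simp add: algebra_simps)
  ultimately show ?thesis by (metis add.assoc)
qed

lemma k_normal_double:
  fixes \<alpha> \<beta> :: "'a alg_closure"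
  assumes "k_normal 1 n \<alpha>" and "even n" and \<beta>: "\<beta> ^ (CARD('a) ^ n) = \<beta> + \<alpha>"
  shows "k_normal 1 (2 * n) \<beta>"
proof -
  from \<open>even n\<close> obtain k where k: "n = 2 * k" by (elim evenE)
  have \<alpha>: "1 < n" "\<alpha> ^ (CARD('a) ^ n) = \<alpha>"
    and gcd1: "Polynomial.degree (gcd (Polynomial.monom 1 n - 1) (normality_poly n \<alpha>)) = 1"
    using assms(1) by (auto simp: k_normal_def ext_field_def)
  have "\<beta> ^ (CARD('a) ^ (2 * n)) = (\<beta> + \<alpha>) ^ (CARD('a) ^ n)"
    by (simp add: mult_2 power_add power_mult \<beta>)
  also have "\<dots> = \<beta>"
    by (simp add: frob_add[OF two_is_prime_nat card2] \<beta> \<alpha> add_self_2 add.assoc)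
  finally have "\<beta> \<in> ext_field (2 * n)" by (simp add: ext_field_def)
  moreover have "Polynomial.degree (gcd (Polynomial.monom 1 (2 * n) - 1) (normality_poly (2 * n) \<beta>)) = 1"
  proof -
    \<comment> \<open>Evenness of \<open>n\<close> enters here: X^n - 1 is the square of
      \<open>?B\<close>, and X^(2n) - 1 its fourth power.\<close>
    let ?B = "Polynomial.monom 1 k - 1 :: 'a alg_closure poly"
    have B: "?B\<^sup>2 = Polynomial.monom 1 n - 1" "(?B\<^sup>2)\<^sup>2 = Polynomial.monom 1 (2 * n) - 1"
      by (simp_all add: monom_minus_1_square k)
    have "gcd (?B\<^sup>2) (normality_poly (2 * n) \<beta>) = gcd (?B\<^sup>2) (normality_poly n \<alpha>)"
      unfolding normality_poly_double[OF \<beta>] B(1) by (rule gcd_add_mult)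
    with gcd1 have deg: "Polynomial.degree (gcd (?B\<^sup>2) (normality_poly (2 * n) \<beta>)) = 1"
      by (simp only: B(1))
    thus ?thesis using poly_gcd_square_eq[OF deg] by (simp only: B(2))
  qed
  ultimately show ?thesis using \<alpha> by (simp add: k_normal_def)
qed

section \<open>Trace conditions and the induction step\<close>

text \<open>\<open>P\<close> is the product over the conjugates of \<alpha>, so c_1/c_0 and c_(n-1)
  are the relative traces of 1/\<alpha> and \<alpha>, signs being irrelevant. As \<delta> lies in
  the base field it can be moved inside, and transitivity yields the absolute traces.\<close>

lemma N_poly_traces:
  fixes P :: "'a poly"
  assumes N: "N_poly k P" and n: "Polynomial.degree P = n" and "n > 0"
    and tr1: "abs_trace2 m (Polynomial.coeff P 1 * \<delta> / Polynomial.coeff P 0) = 1"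
    and tr2: "abs_trace2 m (Polynomial.coeff P (n - 1) / \<delta>) = 1"
    and root: "poly (map_poly to_ac P) \<alpha> = 0"
  shows "trace_sum (m * n) (to_ac \<delta> / \<alpha>) = 1" and "trace_sum (m * n) (\<alpha> / to_ac \<delta>) = 1"
proof -
  let ?a = "\<lambda>i. \<alpha> ^ (CARD('a) ^ i)"
  have closed: "\<alpha> ^ (CARD('a) ^ Polynomial.degree P) = \<alpha>"
    using N root by (auto simp: N_poly_def k_normal_def ext_field_def)
  have P: "map_poly to_ac P = (\<Prod>i<n. [:- ?a i, 1:])"
    using irreducible_eq_orbit_poly[OF two_is_prime_nat card2 root closed] N assms(3)
    by (simp add: N_poly_def n)
  \<comment> \<open>If the constant coefficient were 0, the convention \<open>x / 0 = 0\<close>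
    would make the trace 0 instead of 1.\<close>
  have c0: "Polynomial.coeff P 0 \<noteq> 0"
    using tr1 by (auto simp: abs_trace2_def power_0_left)
  have \<alpha>0: "\<alpha> \<noteq> 0" using root c0 by (auto simp: poly_0_coeff_0)
  have "to_ac (Polynomial.coeff P 1) = to_ac (Polynomial.coeff P 0) * (\<Sum>i<n. 1 / ?a i)"
    using coeff_prod_linear_1[of n ?a, folded P] \<alpha>0 by (simp add: uminus_2)
  hence "to_ac (Polynomial.coeff P 1 * \<delta> / Polynomial.coeff P 0) = to_ac \<delta> * (\<Sum>i<n. 1 / ?a i)"
    using c0 by simp
  hence "to_ac (Polynomial.coeff P 1 * \<delta> / Polynomial.coeff P 0) = (\<Sum>i<n. (to_ac \<delta> / \<alpha>) ^ (CARD('a) ^ i))"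
    by (simp add: power_divide to_ac_power_card sum_distrib_left)
  thus "trace_sum (m * n) (to_ac \<delta> / \<alpha>) = 1"
    using tr1 by (metis trace_sum_tower to_ac_abs_trace2 to_ac_1)
  have "to_ac (Polynomial.coeff P (n - 1)) = (\<Sum>i<n. ?a i)"
    using coeff_prod_linear_subleading[of n ?a, folded P] assms(3) by (simp add: uminus_2)
  hence "to_ac (Polynomial.coeff P (n - 1) / \<delta>) = (\<Sum>i<n. (\<alpha> / to_ac \<delta>) ^ (CARD('a) ^ i))"
    by (simp add: power_divide to_ac_power_card sum_divide_distrib)
  thus "trace_sum (m * n) (\<alpha> / to_ac \<delta>) = 1"
    using tr2 by (metis trace_sum_tower to_ac_abs_trace2 to_ac_1)
qed

text \<open>One step of the recursion, with the trace conditions stated for roots instead of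
  coefficients, the form in which they pass from \<open>n\<close> to \<open>2 * n\<close>. The
  substitution enters only through the degree, the leading coefficient and the roots of
  \<open>Q\<close>.\<close>

lemma N_poly_double:
  fixes P Q :: "'a poly" and \<delta> :: 'a
  defines "d \<equiv> to_ac \<delta>"
  assumes "\<delta> \<noteq> 0" and "even n" and n0: "n > 0"
    and P: "N_poly 1 P" "Polynomial.degree P = n"
    and tr: "\<And>\<alpha>. poly (map_poly to_ac P) \<alpha> = 0 \<Longrightarrow>
      trace_sum (m * n) (d / \<alpha>) = 1 \<and> trace_sum (m * n) (\<alpha> / d) = 1"
    and Q: "Polynomial.lead_coeff Q = 1" "Polynomial.degree Q = 2 * n"
    and roots: "\<And>\<beta>. poly (map_poly to_ac Q) \<beta> = 0 \<Longrightarrow>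
      \<beta> \<noteq> 0 \<and> poly (map_poly to_ac P) (\<beta> + d\<^sup>2 / \<beta>) = 0"
  shows "N_poly 1 Q"
    and "poly (map_poly to_ac Q) \<beta> = 0 \<Longrightarrow>
      trace_sum (m * (2 * n)) (d / \<beta>) = 1 \<and> trace_sum (m * (2 * n)) (\<beta> / d) = 1"
proof -
  note prime_card = two_is_prime_nat card2
  have d: "d \<noteq> 0" "d ^ (CARD('a) ^ i) = d" for i
    using assms(2) by (simp_all add: d_def to_ac_power_card)
  have step: "\<beta> \<noteq> 0 \<and> \<alpha> \<noteq> 0 \<and> poly (map_poly to_ac P) \<alpha> = 0 \<and> k_normal 1 n \<alpha> \<and>
      \<alpha> ^ (CARD('a) ^ n) = \<alpha> \<and> \<beta> ^ (CARD('a) ^ n) = \<beta> + \<alpha>"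
    if \<beta>: "poly (map_poly to_ac Q) \<beta> = 0" and \<alpha>: "\<alpha> = \<beta> + d\<^sup>2 / \<beta>" for \<alpha> \<beta>
  proof -
    have root: "\<beta> \<noteq> 0" "poly (map_poly to_ac P) \<alpha> = 0" using roots[OF \<beta>] \<alpha> by simp_all
    have "\<alpha> \<noteq> 0" using tr[OF root(2)] by (auto simp: trace_sum_def power_0_left)
    moreover have "k_normal 1 n \<alpha>" using P root by (auto simp: N_poly_def)
    moreover from this have "\<alpha> ^ (CARD('a) ^ n) = \<alpha>" by (simp add: k_normal_def ext_field_def)
    ultimately show ?thesis
      using frob_root_of_trace_1[OF _ root(1) \<alpha>] tr[OF root(2)] root by blast
  qed
  have irr: "Factorial_Ring.irreducible P" and normal: "k_normal 1 (2 * n) \<beta>"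
    if "poly (map_poly to_ac Q) \<beta> = 0" for \<beta>
    using P step[OF that refl] k_normal_double[OF _ \<open>even n\<close>] by (auto simp: N_poly_def)
  obtain \<beta> where \<beta>: "poly (map_poly to_ac Q) \<beta> = 0"
    using alg_closed_imp_poly_has_root[of "map_poly to_ac Q"] Q n0 by auto
  define \<alpha> where "\<alpha> = \<beta> + d\<^sup>2 / \<beta>"
  note s = step[OF \<beta> \<alpha>_def]
  have "Factorial_Ring.irreducible Q"
  proof (rule irreducible_of_orbit[OF prime_card \<beta>])
    show "\<beta> ^ (CARD('a) ^ Polynomial.degree Q) = \<beta>"
      using normal[OF \<beta>] by (simp add: k_normal_def ext_field_def Q)
    show "Polynomial.degree Q > 0" using n0 Q by simp
  next
    fix i assume i: "0 < i" "i < Polynomial.degree Q"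
    have min: "n \<le> j" if "j > 0" "\<alpha> ^ (CARD('a) ^ j) = \<alpha>" for j
      using degree_le_orbit[OF prime_card _ _ irr[OF \<beta>] that] s by (simp add: P)
    show "\<beta> ^ (CARD('a) ^ i) \<noteq> \<beta>"
    proof
      \<comment> \<open>If \<beta> returns after \<open>i\<close> steps, so does \<alpha>, whence
        \<open>n \<le> i\<close>. Then \<alpha> also returns after \<open>i - n < n\<close> steps,
        which forces \<open>i = n\<close>; but the n-th Frobenius power moves \<beta> by the nonzero
        \<alpha>.\<close>
      assume fix_i: "\<beta> ^ (CARD('a) ^ i) = \<beta>"
      have \<alpha>i: "\<alpha> ^ (CARD('a) ^ i) = \<alpha>"
        using fix_i d(2)[of i]
        by (simp add: \<alpha>_def frob_add[OF prime_card] power_divide flip: power_mult)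
           (simp add: mult.commute[of 2] power_mult)
      hence "n \<le> i" using min i by blast
      hence "CARD('a) ^ i = CARD('a) ^ n * CARD('a) ^ (i - n)" by (simp flip: power_add)
      hence "\<alpha> ^ (CARD('a) ^ (i - n)) = \<alpha>" using \<alpha>i s by (simp add: power_mult)
      hence "i = n" using min[of "i - n"] i \<open>n \<le> i\<close> Q by (cases "i = n") auto
      thus False using fix_i s by simp
    qed
  qed
  thus "N_poly 1 Q" using normal Q by (auto simp: N_poly_def)
  fix \<beta> assume \<beta>: "poly (map_poly to_ac Q) \<beta> = 0"
  define \<alpha> where "\<alpha> = \<beta> + d\<^sup>2 / \<beta>"
  note s = step[OF \<beta> \<alpha>_def]
  \<comment> \<open>The conjugate of \<beta> over the field with q^n elements is
    \<open>d\<^sup>2 / \<beta>\<close>. Hence \<open>d / \<beta>\<close> and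
    \<open>\<beta> / d\<close> are conjugate, with common relative trace
    \<open>\<alpha> / d\<close>.\<close>
  have conj: "\<beta> + \<alpha> = d\<^sup>2 / \<beta>" by (simp add: \<alpha>_def add_cancel_2)
  have double: "trace_sum (m * (2 * n)) x = trace_sum (m * n) (x + x ^ (CARD('a) ^ n))"
    for x :: "'a alg_closure"
    using trace_sum_append[of n n x] by (simp add: mult_2 trace_sum_add)
  have "d / \<beta> + (d / \<beta>) ^ (CARD('a) ^ n) = d / \<beta> + \<beta> / d"
    using s d by (simp add: power_divide conj power2_eq_square)
  also have "\<dots> = \<alpha> / d" using s d
    by (simp add: \<alpha>_def add_divide_distrib power2_eq_square)
  finally have 1: "d / \<beta> + (d / \<beta>) ^ (CARD('a) ^ n) = \<alpha> / d" .
  have "\<beta> / d + (\<beta> / d) ^ (CARD('a) ^ n) = \<beta> / d + (\<beta> + \<alpha>) / d"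
    using s d by (simp add: power_divide)
  also have "\<dots> = \<alpha> / d" by (simp add: add_cancel_2 flip: add_divide_distrib)
  finally have 2: "\<beta> / d + (\<beta> / d) ^ (CARD('a) ^ n) = \<alpha> / d" .
  show "trace_sum (m * (2 * n)) (d / \<beta>) = 1 \<and> trace_sum (m * (2 * n)) (\<beta> / d) = 1"
    using tr[of \<alpha>] s unfolding double 1 2 by blast
qed

end

subsection \<open>The substitution\<close>

text \<open>Clearing denominators writes \<open>Q\<close> as the sum of c_i X^(N-i) (X^2 + c)^i.
  Only the term \<open>i = N\<close> reaches degree \<open>2 * N\<close>, and only it survives at X
  = 0, where it gives c^N; so 0 is not a root and \<beta>^N can be divided out.\<close>

lemma subst_ratfun_inversion:
  fixes P Q :: "'a::field poly"
  assumes eq: "to_fract Q = ratfun_X ^ N * subst_ratfun P (ratfun_X + ratfun_const c * inverse ratfun_X)"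
    and P: "Polynomial.degree P = N" "Polynomial.lead_coeff P = 1" and "N > 0" and "c \<noteq> 0"
  shows "Polynomial.degree Q = 2 * N" and "Polynomial.lead_coeff Q = 1"
    and "poly (map_poly to_ac Q) \<beta> = 0 \<Longrightarrow>
      \<beta> \<noteq> 0 \<and> poly (map_poly to_ac P) (\<beta> + to_ac c / \<beta>) = 0"
proof -
  define t where "t i = [:Polynomial.coeff P i:] * [:0, 1:] ^ (N - i) * [:c, 0, 1:] ^ i" for i
  have "to_fract Q = to_fract (\<Sum>i\<le>N. t i)"
    unfolding eq t_def by (rule subst_ratfun_poly) (simp add: P)
  hence Q: "Q = (\<Sum>i\<le>N. t i)" by (simp only: to_fract_eq_iff)
  have tN: "t N = [:c, 0, 1:] ^ N" using P by (simp add: t_def)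
  have dN: "Polynomial.degree (t N) = 2 * N" by (simp add: tN degree_power_eq)
  have lN: "Polynomial.lead_coeff (t N) = 1" by (simp add: tN lead_coeff_power)
  have Q': "Q = (\<Sum>i<N. t i) + t N" by (simp add: Q flip: lessThan_Suc_atMost)
  have low: "Polynomial.degree (\<Sum>i<N. t i) < Polynomial.degree (t N)"
    unfolding dN
  proof (rule degree_sum_less)
    fix i assume i: "i \<in> {..<N}"
    \<comment> \<open>The bound is \<open>N + i\<close>, which is below \<open>2 * N\<close> for
      \<open>i < N\<close>.\<close>
    have "Polynomial.degree (t i) \<le> (0 + 1 * (N - i)) + 2 * i"
      unfolding t_def
      by (intro order.trans[OF degree_mult_le] add_mono order.trans[OF degree_power_le]) auto
    thus "Polynomial.degree (t i) < 2 * N" using i by simp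
  qed (use \<open>N > 0\<close> in simp)
  show "Polynomial.degree Q = 2 * N" using low dN by (simp add: Q' degree_add_eq_right)
  show "Polynomial.lead_coeff Q = 1" using low lN by (simp only: Q' lead_coeff_add_le)
  let ?c = "to_ac c"
  have ev: "poly (map_poly to_ac Q) x =
      (\<Sum>i\<le>N. to_ac (Polynomial.coeff P i) * x ^ (N - i) * (x\<^sup>2 + ?c) ^ i)" for x
    by (simp add: Q t_def map_poly_to_ac_sum map_poly_to_ac_mult map_poly_to_ac_power map_poly_to_ac_smult map_poly_pCons
        poly_sum power2_eq_square add.commute mult.assoc)
  assume \<beta>: "poly (map_poly to_ac Q) \<beta> = 0"
  have \<beta>0: "\<beta> \<noteq> 0"
  proof
    assume "\<beta> = 0"
    hence "poly (map_poly to_ac Q) \<beta> = (\<Sum>i\<le>N. if i = N then ?c ^ N else 0)"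
      unfolding ev using P by (intro sum.cong) auto
    thus False using \<beta> \<open>c \<noteq> 0\<close> by simp
  qed
  have "poly (map_poly to_ac Q) \<beta> = (\<Sum>i\<le>N. \<beta> ^ N * (to_ac (Polynomial.coeff P i) * (\<beta> + ?c / \<beta>) ^ i))"
    unfolding ev
  proof (rule sum.cong)
    fix i assume "i \<in> {..N}"
    hence "\<beta> ^ N = \<beta> ^ (N - i) * \<beta> ^ i" by (simp flip: power_add)
    moreover have "\<beta>\<^sup>2 + ?c = \<beta> * (\<beta> + ?c / \<beta>)" using \<beta>0
      by (simp add: distrib_left power2_eq_square)
    ultimately show "to_ac (Polynomial.coeff P i) * \<beta> ^ (N - i) * (\<beta>\<^sup>2 + ?c) ^ i =
        \<beta> ^ N * (to_ac (Polynomial.coeff P i) * (\<beta> + ?c / \<beta>) ^ i)"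
      by (simp only: power_mult_distrib mult_ac)
  qed simp
  also have "\<dots> = \<beta> ^ N * poly (map_poly to_ac P) (\<beta> + ?c / \<beta>)"
    by (simp add: poly_altdef P sum_distrib_left)
  finally show "\<beta> \<noteq> 0 \<and> poly (map_poly to_ac P) (\<beta> + ?c / \<beta>) = 0" using \<beta> \<beta>0 by simp
qed

theorem theorem4p2:
  fixes m n :: nat
    and \<delta> :: "'a::finite_field"
    and F :: "nat \<Rightarrow> 'a poly"
  assumes "m \<ge> 1" and "CARD('a) = 2 ^ m"
    and "\<delta> \<noteq> 0"
    and "even n" and "n > 0"
    and "N_poly 1 (F 1)" and "Polynomial.degree (F 1) = n"
    and "abs_trace2 m (Polynomial.coeff (F 1) 1 * \<delta> / Polynomial.coeff (F 1) 0) = 1"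
    and "abs_trace2 m (Polynomial.coeff (F 1) (n - 1) / \<delta>) = 1"
    and "\<forall>u\<ge>1. to_fract (F (u + 1)) =
      ratfun_X ^ (n * 2 ^ (u - 1)) *
        subst_ratfun (F u) (ratfun_X + ratfun_const (\<delta>\<^sup>2) * inverse ratfun_X)"
  shows "\<forall>u\<ge>1. N_poly 1 (F (u + 1)) \<and> Polynomial.degree (F (u + 1)) = 2 ^ u * n"
proof -
  note card2 = \<open>CARD('a) = 2 ^ m\<close>
  define d where "d = to_ac \<delta>"
  \<comment> \<open>The induction invariant. The index is shifted: the given polynomial is the case
    \<open>u = 0\<close>, where the trace conditions on coefficients are converted into conditions
    on roots.\<close>
  define good where "good N P \<longleftrightarrow> N_poly 1 P \<and> Polynomial.degree P = N \<and>
    (\<forall>\<alpha>. poly (map_poly to_ac P) \<alpha> = 0 \<longrightarrow>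
      trace_sum (m * N) (d / \<alpha>) = 1 \<and> trace_sum (m * N) (\<alpha> / d) = 1)" for N and P :: "'a poly"
  have "good (2 ^ u * n) (F (u + 1))" for u
  proof (induction u)
    case 0
    show ?case using N_poly_traces[OF card2] assms by (simp add: good_def d_def)
  next
    case (Suc u)
    let ?N = "2 ^ u * n" and ?P = "F (u + 1)" and ?Q = "F (Suc u + 1)"
    \<comment> \<open>The recursion is taken at \<open>Suc u\<close>, so that its exponent equals
      the degree of \<open>?P\<close>.\<close>
    have eq: "to_fract ?Q = ratfun_X ^ ?N * subst_ratfun ?P (ratfun_X + ratfun_const (\<delta>\<^sup>2) * inverse ratfun_X)"
      using assms(10)[rule_format, of "Suc u"] by (simp add: mult.commute)
    have P: "N_poly 1 ?P" "Polynomial.degree ?P = ?N" "Polynomial.lead_coeff ?P = 1"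
      using Suc unfolding good_def N_poly_def by blast+
    have "?N > 0" "\<delta>\<^sup>2 \<noteq> 0" "even ?N" using assms by simp_all
    note Q = subst_ratfun_inversion[OF eq P(2,3) this(1,2)]
    have tr: "trace_sum (m * ?N) (to_ac \<delta> / \<alpha>) = 1 \<and> trace_sum (m * ?N) (\<alpha> / to_ac \<delta>) = 1"
      if "poly (map_poly to_ac ?P) \<alpha> = 0" for \<alpha>
      using Suc that by (simp add: good_def d_def)
    note step = N_poly_double[OF card2 \<open>\<delta> \<noteq> 0\<close> \<open>even ?N\<close> \<open>?N > 0\<close> P(1,2) tr Q(2,1) Q(3)[unfolded to_ac_power]]
    have "2 ^ Suc u * n = 2 * ?N" by simp
    thus ?case using step Q(1) unfolding good_def d_def by metis
  qed
  thus ?thesis by (auto simp: good_def)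
qed

end
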